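(* Suppose the natural variables satisfy the structural model $W=f_W(U_W)$, $Z=f_Z(W,U_Z)$, $A=f_A(Z,W,U_A)$, $Y=f_Y(A,W,U_Y)$ with $Z\perp (U_A,U_Y)\mid W$. Let $h^*(\cdot\mid W)$ be a stochastic intervention on the instrument, and suppose the intervened variables satisfy $W=f_W(U_W)$, $Z^{h^*}=f_Z^*(W,U_Z)$, $A^{h^*}=f_A(Z^{h^*},W,U_A)$, $Y^{h^*}=f_Y(A^{h^*},W,U_Y)$, where $Z^{h^*}\mid W$ has conditional density $h^*(\cdot\mid W)$ and $Z^{h^*}\perp (U_A,U_Y)\mid W$. Suppose moreover that $h^*/h<\infty$ a.e. (so that $h^*\ll h$). Then $$E[Y^{h^*}] = E_P\, E_{Z\mid W\sim h^*}\big[\,E_P[Y\mid Z,W]\,\big|\,W\big],$$ or equivalently $$E[Y^{h^*}]=\int\Big(\int E_P[Y\mid Z,W]\,dH^*(Z\mid W)\Big)\,dP(W).$$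
   Context: $W$ are baseline covariates, $Z$ an instrument, $A$ a treatment, $Y$ a response; $f_W,f_Z,f_A,f_Y,f_Z^*$ are arbitrary (measurable) functions and $U_W,U_Z,U_A,U_Y$ are error terms with an arbitrary joint distribution, with no conditional independence restrictions except those stated (in particular $U_A$ and $U_Y$ may be dependent given $W$: hidden confounding). The variable $Z$ does not enter $f_Y$ (exclusion restriction). $P$ denotes the joint law of the natural variables $(W,Z,A,Y)$. $h(\cdot\mid W)$ is the conditional density of $Z$ given $W$ under $P$ with respect to a dominating measure $\mu(\cdot\mid W)$, and $h^*(\cdot\mid W)$ is another conditional density with respect to the same measure; $H^*(\cdot\mid W)$ is the conditional probability measure with density $h^*(\cdot\mid W)$. The intervened model uses the same functions $f_W,f_A,f_Y$ and the same error terms as the natural model; only the equation for $Z$ is replaced. Expectations are assumed to exist. *)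

theory Defs
  imports "HOL-Probability.Probability"
begin

text \<open>The sigma-algebra on \<open>space M\<close> generated by a random variable.\<close>

definition sigma_gen :: "'a measure \<Rightarrow> ('a \<Rightarrow> 'x) \<Rightarrow> 'x measure \<Rightarrow> 'a measure" where
  "sigma_gen M X MX = vimage_algebra (space M) X MX"

definition cond_prob_given ::
  "'a measure \<Rightarrow> ('a \<Rightarrow> 'x) \<Rightarrow> 'x measure \<Rightarrow> 'a set \<Rightarrow> 'a \<Rightarrow> real" where
  "cond_prob_given M X MX E = real_cond_exp M (sigma_gen M X MX) (indicator E)"

definition cond_indep_given ::
  "'a measure \<Rightarrow> ('a \<Rightarrow> 'z) \<Rightarrow> 'z measure \<Rightarrow> ('a \<Rightarrow> 'u) \<Rightarrow> 'u measure
    \<Rightarrow> ('a \<Rightarrow> 'x) \<Rightarrow> 'x measure \<Rightarrow> bool" where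
  "cond_indep_given M Z MZ U MU X MX \<longleftrightarrow>
    (\<forall>B\<in>sets MZ. \<forall>C\<in>sets MU. AE \<omega> in M.
       cond_prob_given M X MX {\<omega> \<in> space M. Z \<omega> \<in> B \<and> U \<omega> \<in> C} \<omega> =
       cond_prob_given M X MX {\<omega> \<in> space M. Z \<omega> \<in> B} \<omega> *
       cond_prob_given M X MX {\<omega> \<in> space M. U \<omega> \<in> C} \<omega>)"

text \<open>
  \<open>h x\<close> is the density, with respect to the dominating measure \<open>\<mu> x\<close>, of the conditional
  distribution of \<open>Z\<close> given \<open>X = x\<close>: the measures \<open>density (\<mu> x) (h x)\<close> form a Markov kernel
  which is a regular conditional distribution. No kernel or finiteness
  conditions are placed on \<open>\<mu>\<close> itself, so Lebesgue and counting measures are covered.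
\<close>

definition conditional_density ::
  "'a measure \<Rightarrow> ('a \<Rightarrow> 'z) \<Rightarrow> 'z measure \<Rightarrow> ('a \<Rightarrow> 'x) \<Rightarrow> 'x measure
    \<Rightarrow> ('x \<Rightarrow> 'z measure) \<Rightarrow> ('x \<Rightarrow> 'z \<Rightarrow> ennreal) \<Rightarrow> bool" where
  "conditional_density M Z MZ X MX \<mu> h \<longleftrightarrow>
    (\<forall>x\<in>space MX. sets (\<mu> x) = sets MZ \<and> h x \<in> borel_measurable (\<mu> x)) \<and>
    (\<lambda>x. density (\<mu> x) (h x)) \<in> MX \<rightarrow>\<^sub>M prob_algebra MZ \<and>
    (\<forall>B\<in>sets MZ. AE \<omega> in M.
       cond_prob_given M X MX {\<omega> \<in> space M. Z \<omega> \<in> B} \<omega> =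
       measure (density (\<mu> (X \<omega>)) (h (X \<omega>))) B)"

text \<open>
  \<open>m\<close> is a version of the regression function \<open>x \<mapsto> E[Y | X = x]\<close>. Such a version always exists
  (lemma \<open>regression_version_exists\<close> below), and it is unique up to null sets of the law of \<open>X\<close>.
\<close>

definition regression_version ::
  "'a measure \<Rightarrow> ('a \<Rightarrow> real) \<Rightarrow> ('a \<Rightarrow> 'x) \<Rightarrow> 'x measure \<Rightarrow> ('x \<Rightarrow> real) \<Rightarrow> bool" where
  "regression_version M Y X MX m \<longleftrightarrow>
    m \<in> borel_measurable MX \<and>
    (AE \<omega> in M. m (X \<omega>) = real_cond_exp M (sigma_gen M X MX) Y \<omega>)"

lemma borel_measurable_vimage_algebra_factor:
  fixes u :: "'a \<Rightarrow> ennreal"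
  assumes X: "X \<in> \<Omega> \<rightarrow> space MX"
    and u: "u \<in> borel_measurable (vimage_algebra \<Omega> X MX)"
  shows "\<exists>g\<in>borel_measurable MX. \<forall>\<omega>\<in>\<Omega>. u \<omega> = g (X \<omega>)"
  using u
proof (induction u rule: borel_measurable_induct)
  case (cong f g)
  then show ?case by (metis space_vimage_algebra)
next
  case (set A)
  then obtain B where B: "B \<in> sets MX" "A = X -` B \<inter> \<Omega>"
    using sets_vimage_algebra2[OF X] by auto
  then show ?case
    by (intro bexI[of _ "indicator B"]) (auto simp: indicator_def)
next
  case (mult u c)
  then obtain g where g: "g \<in> borel_measurable MX" "\<forall>\<omega>\<in>\<Omega>. u \<omega> = g (X \<omega>)"
    by blast
  have "(\<lambda>x. c * g x) \<in> borel_measurable MX"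
    using g(1) by measurable
  then show ?case using g(2) by (intro bexI[of _ "\<lambda>x. c * g x"]) simp_all
next
  case (add u v)
  obtain g where g: "g \<in> borel_measurable MX" "\<forall>\<omega>\<in>\<Omega>. u \<omega> = g (X \<omega>)"
    using add by blast
  obtain k where k: "k \<in> borel_measurable MX" "\<forall>\<omega>\<in>\<Omega>. v \<omega> = k (X \<omega>)"
    using add by blast
  have "(\<lambda>x. k x + g x) \<in> borel_measurable MX"
    using g(1) k(1) by measurable
  then show ?case using g(2) k(2) by (intro bexI[of _ "\<lambda>x. k x + g x"]) simp_all
next
  case (seq U)
  have "\<forall>i. \<exists>g. g \<in> borel_measurable MX \<and> (\<forall>\<omega>\<in>\<Omega>. U i \<omega> = g (X \<omega>))"
    using seq by blast
  from choice[OF this] obtain g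
    where g: "\<forall>i. g i \<in> borel_measurable MX \<and> (\<forall>\<omega>\<in>\<Omega>. U i \<omega> = g i (X \<omega>))" by blast
  have "(\<lambda>x. SUP i. g i x) \<in> borel_measurable MX"
    using g by (intro borel_measurable_SUP) auto
  then show ?case using g by (intro bexI[of _ "\<lambda>x. SUP i. g i x"]) (simp_all add: image_comp)
qed

lemma regression_version_exists:
  assumes X: "X \<in> M \<rightarrow>\<^sub>M MX"
  shows "\<exists>m. regression_version M Y X MX m"
proof -
  let ?F = "sigma_gen M X MX"
  have X': "X \<in> space M \<rightarrow> space MX"
    using measurable_space[OF X] by auto
  have "\<exists>g\<in>borel_measurable MX. \<forall>\<omega>\<in>space M. nn_cond_exp M ?F f \<omega> = g (X \<omega>)" for f
    using borel_measurable_vimage_algebra_factor[OF X'] borel_measurable_nn_cond_exp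
    unfolding sigma_gen_def by blast
  note fac = this
  obtain p where p: "p \<in> borel_measurable MX"
      "\<forall>\<omega>\<in>space M. nn_cond_exp M ?F (\<lambda>x. ennreal (Y x)) \<omega> = p (X \<omega>)"
    using fac by blast
  obtain n where n: "n \<in> borel_measurable MX"
      "\<forall>\<omega>\<in>space M. nn_cond_exp M ?F (\<lambda>x. ennreal (- Y x)) \<omega> = n (X \<omega>)"
    using fac by blast
  have "(\<lambda>x. enn2real (p x) - enn2real (n x)) \<in> borel_measurable MX"
    using p(1) n(1) by measurable
  moreover have "AE \<omega> in M. enn2real (p (X \<omega>)) - enn2real (n (X \<omega>)) = real_cond_exp M ?F Y \<omega>"
    using p(2) n(2) by (intro AE_I2) (simp add: real_cond_exp_def)
  ultimately have "regression_version M Y X MX (\<lambda>x. enn2real (p x) - enn2real (n x))"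
    by (simp add: regression_version_def)
  then show ?thesis by blast
qed

end

theory Submission
  imports Defs
begin

text \<open>
  Overlap makes the law of \<open>(W, Z\<^sup>*)\<close> absolutely continuous with respect to that of \<open>(W, Z)\<close>, where
  \<open>Z\<^sup>*\<close> is the intervened instrument; let \<open>r\<close> be a density. The pointwise ratio of \<open>h\<^sup>*\<close> and \<open>h\<close>
  would not do, as it need not be jointly measurable. Since the errors \<open>U = (U\<^sub>A, U\<^sub>Y)\<close> are
  conditionally independent of both instruments given \<open>W\<close>, the same \<open>r\<close> is a density of the law
  of \<open>(W, Z\<^sup>*, U)\<close> with respect to that of \<open>(W, Z, U)\<close>. Both responses are the same function of
  these triples, so \<open>E[Y\<^sup>*] = E[r(W, Z) Y] = E[r(W, Z) m(Z, W)] = E[m(Z\<^sup>*, W)]\<close>, and disintegrating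
  the law of \<open>(W, Z\<^sup>*)\<close> along \<open>W\<close> gives the iterated integral.
\<close>

section \<open>Measures on products and conditional expectation given a random variable\<close>

text \<open>Rectangles form an intersection-stable generator, and the constant sequence
  \<open>space A \<times> space B\<close> is a cover by generators of finite
  \<open>M\<close>-measure.\<close>

lemma measure_eqI_rectangles:
  assumes M: "sets M = sets (A \<Otimes>\<^sub>M B)" and N: "sets N = sets (A \<Otimes>\<^sub>M B)"
    and fin: "finite_measure M"
    and eq: "\<And>a b. a \<in> sets A \<Longrightarrow> b \<in> sets B \<Longrightarrow> emeasure M (a \<times> b) = emeasure N (a \<times> b)"
  shows "M = N"
proof (rule measure_eqI_generator_eq[where A="\<lambda>_. space A \<times> space B",
      OF Int_stable_pair_measure_generator pair_measure_closed])
  fix X assume "X \<in> {a \<times> b |a b. a \<in> sets A \<and> b \<in> sets B}"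
  then show "emeasure M X = emeasure N X"
    using eq by blast
qed (use M N finite_measure.emeasure_finite[OF fin] in \<open>auto simp: sets_pair_measure\<close>)

lemma (in prob_space) finite_measure_subalgebra_sigma_gen:
  assumes "X \<in> M \<rightarrow>\<^sub>M MX"
  shows "finite_measure_subalgebra M (sigma_gen M X MX)"
proof unfold_locales
  show "subalgebra M (sigma_gen M X MX)"
    using assms by (auto simp: subalgebra_def sigma_gen_def measurable_iff_sets)
qed

text \<open>A function of \<open>X\<close> is measurable for the sigma-algebra generated by
  \<open>X\<close>, so it can be pulled out of the conditional expectation. Integrability is asked
  of the product only, which admits an unbounded Radon-Nikodym density as
  \<open>\<phi>\<close>.\<close>

lemma (in prob_space) integral_cond_exp_sigma_gen:
  fixes \<phi> :: "'x \<Rightarrow> real"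
  assumes X: "X \<in> M \<rightarrow>\<^sub>M MX" and \<phi>: "\<phi> \<in> borel_measurable MX"
    and f: "f \<in> borel_measurable M" and int: "integrable M (\<lambda>\<omega>. \<phi> (X \<omega>) * f \<omega>)"
  shows "integrable M (\<lambda>\<omega>. \<phi> (X \<omega>) * real_cond_exp M (sigma_gen M X MX) f \<omega>)"
    and "(\<integral>\<omega>. \<phi> (X \<omega>) * real_cond_exp M (sigma_gen M X MX) f \<omega> \<partial>M) = (\<integral>\<omega>. \<phi> (X \<omega>) * f \<omega> \<partial>M)"
proof -
  interpret finite_measure_subalgebra M "sigma_gen M X MX"
    by (rule finite_measure_subalgebra_sigma_gen[OF X])
  have "X \<in> sigma_gen M X MX \<rightarrow>\<^sub>M MX"
    using measurable_space[OF X] unfolding sigma_gen_def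
    by (intro measurable_vimage_algebra1) auto
  then have "(\<lambda>\<omega>. \<phi> (X \<omega>)) \<in> borel_measurable (sigma_gen M X MX)"
    using \<phi> by measurable
  from real_cond_exp_intg[OF int this f]
  show "integrable M (\<lambda>\<omega>. \<phi> (X \<omega>) * real_cond_exp M (sigma_gen M X MX) f \<omega>)"
    and "(\<integral>\<omega>. \<phi> (X \<omega>) * real_cond_exp M (sigma_gen M X MX) f \<omega> \<partial>M) = (\<integral>\<omega>. \<phi> (X \<omega>) * f \<omega> \<partial>M)"
    by auto
qed

lemma (in prob_space) integral_cond_prob_given:
  fixes \<phi> :: "'x \<Rightarrow> real"
  assumes X: "X \<in> M \<rightarrow>\<^sub>M MX" and \<phi>: "\<phi> \<in> borel_measurable MX"
    and E: "E \<in> events" and bnd: "\<And>x. \<bar>\<phi> x\<bar> \<le> 1"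
  shows "(\<integral>\<omega>. \<phi> (X \<omega>) * cond_prob_given M X MX E \<omega> \<partial>M) = (\<integral>\<omega>. \<phi> (X \<omega>) * indicator E \<omega> \<partial>M)"
proof -
  have "integrable M (\<lambda>\<omega>. \<phi> (X \<omega>) * indicator E \<omega>)"
    using assms by (intro integrable_const_bound[where B=1]) (auto split: split_indicator)
  with integral_cond_exp_sigma_gen(2)[OF X \<phi>, of "indicator E"] E show ?thesis
    by (simp add: cond_prob_given_def)
qed

text \<open>A regression version of the indicator respects the bounds only almost surely along
  \<open>X\<close>. Clamping it to [0, 1] makes them hold at every point and changes nothing almost
  surely, so \<open>k\<close> can serve as a bounded nonnegative weight.\<close>

lemma (in prob_space) cond_prob_version_exists:
  assumes X: "X \<in> M \<rightarrow>\<^sub>M MX" and E: "E \<in> events"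
  obtains k :: "'x \<Rightarrow> real" where "k \<in> borel_measurable MX" "\<And>x. 0 \<le> k x" "\<And>x. k x \<le> 1"
    "AE \<omega> in M. cond_prob_given M X MX E \<omega> = k (X \<omega>)"
proof -
  interpret F: finite_measure_subalgebra M "sigma_gen M X MX"
    by (rule finite_measure_subalgebra_sigma_gen[OF X])
  obtain k0 where k0: "regression_version M (indicator E) X MX k0"
    using regression_version_exists[OF X] by blast
  have int: "integrable M (indicator E :: _ \<Rightarrow> real)"
    using E by (simp add: integrable_indicator_iff emeasure_eq_measure)
  have "AE \<omega> in M. 0 \<le> cond_prob_given M X MX E \<omega>"
    unfolding cond_prob_given_def by (rule F.real_cond_exp_ge_c[OF int]) simp
  moreover have "AE \<omega> in M. cond_prob_given M X MX E \<omega> \<le> 1"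
    unfolding cond_prob_given_def by (rule F.real_cond_exp_le_c[OF int]) (simp add: indicator_def)
  moreover have "AE \<omega> in M. cond_prob_given M X MX E \<omega> = k0 (X \<omega>)"
    using k0 by (auto simp: regression_version_def cond_prob_given_def)
  ultimately have "AE \<omega> in M. cond_prob_given M X MX E \<omega> = max 0 (min 1 (k0 (X \<omega>)))"
    by eventually_elim auto
  moreover have "(\<lambda>x. max 0 (min 1 (k0 x))) \<in> borel_measurable MX"
    using k0 unfolding regression_version_def by (intro borel_measurable_max borel_measurable_min) simp_all
  ultimately show ?thesis
    by (intro that[of "\<lambda>x. max 0 (min 1 (k0 x))"]) auto
qed

section \<open>Conditional independence and densities of joint laws\<close>

text \<open>By conditional independence, the probability of \<open>U \<in> C\<close> given
  \<open>X\<close> splits off as a factor on rectangles. This weight depends on \<open>x\<close>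
  alone and is the same for every such \<open>Z\<close>, so it can be used for both instruments at
  once.\<close>

lemma (in prob_space) cond_indep_given_distr_density:
  fixes k :: "'x \<Rightarrow> real"
  assumes X[measurable]: "X \<in> M \<rightarrow>\<^sub>M MX" and Z[measurable]: "Z \<in> M \<rightarrow>\<^sub>M MZ"
    and U[measurable]: "U \<in> M \<rightarrow>\<^sub>M MU"
    and ind: "cond_indep_given M Z MZ U MU X MX" and C[measurable]: "C \<in> sets MU"
    and k[measurable]: "k \<in> borel_measurable MX" and k_bnd: "\<And>x. 0 \<le> k x" "\<And>x. k x \<le> 1"
    and k_ver: "AE \<omega> in M. cond_prob_given M X MX {\<omega> \<in> space M. U \<omega> \<in> C} \<omega> = k (X \<omega>)"
  shows "distr (density M (\<lambda>\<omega>. indicator C (U \<omega>))) (MX \<Otimes>\<^sub>M MZ) (\<lambda>\<omega>. (X \<omega>, Z \<omega>)) =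
    density (distr M (MX \<Otimes>\<^sub>M MZ) (\<lambda>\<omega>. (X \<omega>, Z \<omega>))) (\<lambda>(x, z). ennreal (k x))"
proof (rule measure_eqI_rectangles[where A=MX and B=MZ])
  show "finite_measure (distr (density M (\<lambda>\<omega>. indicator C (U \<omega>))) (MX \<Otimes>\<^sub>M MZ) (\<lambda>\<omega>. (X \<omega>, Z \<omega>)))"
  proof (intro finite_measure.finite_measure_distr finite_measureI)
    have "(\<integral>\<^sup>+\<omega>. indicator C (U \<omega>) * indicator (space M) \<omega> \<partial>M) \<le> (\<integral>\<^sup>+\<omega>. 1 \<partial>M)"
      by (intro nn_integral_mono) (simp split: split_indicator)
    also have "\<dots> = 1"
      by (simp add: emeasure_space_1)
    finally show "emeasure (density M (\<lambda>\<omega>. indicator C (U \<omega>)))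
        (space (density M (\<lambda>\<omega>. indicator C (U \<omega>)))) \<noteq> \<infinity>"
      by (auto simp: emeasure_density top_unique)
  qed measurable
  fix D B assume D[measurable]: "D \<in> sets MX" and B[measurable]: "B \<in> sets MZ"
  let ?ZU = "{\<omega> \<in> space M. Z \<omega> \<in> B \<and> U \<omega> \<in> C}" and ?Z = "{\<omega> \<in> space M. Z \<omega> \<in> B}"
  have cp: "AE \<omega> in M. cond_prob_given M X MX ?ZU \<omega> = cond_prob_given M X MX ?Z \<omega> * k (X \<omega>)"
    using ind[unfolded cond_indep_given_def, rule_format, OF B C] k_ver by eventually_elim simp
  have [measurable]: "cond_prob_given M X MX E \<in> borel_measurable M" for E
    unfolding cond_prob_given_def by (rule borel_measurable_cond_exp2)
  have "(\<integral>\<omega>. indicator D (X \<omega>) * indicator ?ZU \<omega> \<partial>M) =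
      (\<integral>\<omega>. indicator D (X \<omega>) * cond_prob_given M X MX ?ZU \<omega> \<partial>M)"
    by (intro integral_cond_prob_given[symmetric]) (auto split: split_indicator)
  also have "\<dots> = (\<integral>\<omega>. (indicator D (X \<omega>) * k (X \<omega>)) * cond_prob_given M X MX ?Z \<omega> \<partial>M)"
    using cp by (intro integral_cong_AE) (measurable, auto)
  \<comment> \<open>Once \<open>k\<close> belongs to the test function of \<open>X\<close>, the
    conditional probability of \<open>Z \<in> B\<close> can be traded for the indicator of that
    event.\<close>
  also have "\<dots> = (\<integral>\<omega>. (indicator D (X \<omega>) * k (X \<omega>)) * indicator ?Z \<omega> \<partial>M)"
    using k_bnd by (intro integral_cond_prob_given[where \<phi>="\<lambda>x. indicator D x * k x"])
      (auto split: split_indicator)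
  finally have eq: "(\<integral>\<omega>. indicator D (X \<omega>) * indicator ?ZU \<omega> \<partial>M) =
      (\<integral>\<omega>. (indicator D (X \<omega>) * k (X \<omega>)) * indicator ?Z \<omega> \<partial>M)" .
  have "emeasure (distr (density M (\<lambda>\<omega>. indicator C (U \<omega>))) (MX \<Otimes>\<^sub>M MZ) (\<lambda>\<omega>. (X \<omega>, Z \<omega>))) (D \<times> B)
      = (\<integral>\<^sup>+\<omega>. ennreal (indicator D (X \<omega>) * indicator ?ZU \<omega>) \<partial>M)"
    by (auto simp: emeasure_distr emeasure_density intro!: nn_integral_cong split: split_indicator)
  also have "\<dots> = ennreal (\<integral>\<omega>. indicator D (X \<omega>) * indicator ?ZU \<omega> \<partial>M)"
    by (intro nn_integral_eq_integral integrable_const_bound[where B=1])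
      (auto split: split_indicator)
  also have "\<dots> = (\<integral>\<^sup>+\<omega>. ennreal ((indicator D (X \<omega>) * k (X \<omega>)) * indicator ?Z \<omega>) \<partial>M)"
    unfolding eq using k_bnd
    by (intro nn_integral_eq_integral[symmetric] integrable_const_bound[where B=1])
      (auto split: split_indicator)
  also have "\<dots> = emeasure (density (distr M (MX \<Otimes>\<^sub>M MZ) (\<lambda>\<omega>. (X \<omega>, Z \<omega>))) (\<lambda>(x, z). ennreal (k x))) (D \<times> B)"
    by (auto simp: nn_integral_distr emeasure_density intro!: nn_integral_cong split: split_indicator)
  finally show "emeasure (distr (density M (\<lambda>\<omega>. indicator C (U \<omega>))) (MX \<Otimes>\<^sub>M MZ) (\<lambda>\<omega>. (X \<omega>, Z \<omega>))) (D \<times> B)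
    = emeasure (density (distr M (MX \<Otimes>\<^sub>M MZ) (\<lambda>\<omega>. (X \<omega>, Z \<omega>))) (\<lambda>(x, z). ennreal (k x))) (D \<times> B)" .
qed simp_all

text \<open>
  Conditioning both laws on \<open>U \<in> C\<close> multiplies them by the same function of \<open>x\<close>, since \<open>U\<close> has the
  same conditional distribution given \<open>X\<close> in both; hence the density of \<open>(X, Z')\<close> with respect
  to \<open>(X, Z)\<close> survives.
\<close>

lemma (in prob_space) distr_density_cond_indep:
  fixes r :: "'x \<times> 'z \<Rightarrow> ennreal"
  assumes X[measurable]: "X \<in> M \<rightarrow>\<^sub>M MX" and Z[measurable]: "Z \<in> M \<rightarrow>\<^sub>M MZ"
    and Z'[measurable]: "Z' \<in> M \<rightarrow>\<^sub>M MZ" and U[measurable]: "U \<in> M \<rightarrow>\<^sub>M MU"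
    and ind: "cond_indep_given M Z MZ U MU X MX" and ind': "cond_indep_given M Z' MZ U MU X MX"
    and r[measurable]: "r \<in> borel_measurable (MX \<Otimes>\<^sub>M MZ)"
    and dens: "distr M (MX \<Otimes>\<^sub>M MZ) (\<lambda>\<omega>. (X \<omega>, Z' \<omega>)) =
      density (distr M (MX \<Otimes>\<^sub>M MZ) (\<lambda>\<omega>. (X \<omega>, Z \<omega>))) r"
  shows "distr M ((MX \<Otimes>\<^sub>M MZ) \<Otimes>\<^sub>M MU) (\<lambda>\<omega>. ((X \<omega>, Z' \<omega>), U \<omega>)) =
    density (distr M ((MX \<Otimes>\<^sub>M MZ) \<Otimes>\<^sub>M MU) (\<lambda>\<omega>. ((X \<omega>, Z \<omega>), U \<omega>))) (\<lambda>p. r (fst p))"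
proof (rule measure_eqI_rectangles[where A="MX \<Otimes>\<^sub>M MZ" and B=MU])
  show "finite_measure (distr M ((MX \<Otimes>\<^sub>M MZ) \<Otimes>\<^sub>M MU) (\<lambda>\<omega>. ((X \<omega>, Z' \<omega>), U \<omega>)))"
    by (intro finite_measure_distr) measurable
  fix E C assume E[measurable]: "E \<in> sets (MX \<Otimes>\<^sub>M MZ)" and C[measurable]: "C \<in> sets MU"
  let ?L = "distr M (MX \<Otimes>\<^sub>M MZ) (\<lambda>\<omega>. (X \<omega>, Z \<omega>))"
  let ?MC = "density M (\<lambda>\<omega>. indicator C (U \<omega>))"
  obtain k :: "'x \<Rightarrow> real" where k[measurable]: "k \<in> borel_measurable MX" and kb: "\<And>x. 0 \<le> k x" "\<And>x. k x \<le> 1"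
      and kv: "AE \<omega> in M. cond_prob_given M X MX {\<omega> \<in> space M. U \<omega> \<in> C} \<omega> = k (X \<omega>)"
  proof (rule cond_prob_version_exists[OF X])
    show "{\<omega> \<in> space M. U \<omega> \<in> C} \<in> events" by measurable
  qed blast
  note LC = cond_indep_given_distr_density[OF X Z U ind C k kb kv]
    and LC' = cond_indep_given_distr_density[OF X Z' U ind' C k kb kv]
  have "emeasure (distr M ((MX \<Otimes>\<^sub>M MZ) \<Otimes>\<^sub>M MU) (\<lambda>\<omega>. ((X \<omega>, Z' \<omega>), U \<omega>))) (E \<times> C) =
      (\<integral>\<^sup>+\<omega>. indicator (E \<times> C) ((X \<omega>, Z' \<omega>), U \<omega>) \<partial>M)"
    by (subst nn_integral_indicator[symmetric]) (simp_all add: nn_integral_distr del: nn_integral_indicator)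
  \<comment> \<open>The restriction to \<open>U \<in> C\<close> is absorbed into \<open>?MC\<close>.
    Then \<open>LC'\<close> turns it into the weight \<open>k\<close>, \<open>dens\<close> replaces
    \<open>Z'\<close> by \<open>Z\<close> at the price of \<open>r\<close>, and \<open>LC\<close>
    turns \<open>k\<close> back into the restriction.\<close>
  also have "\<dots> = (\<integral>\<^sup>+p. indicator E p \<partial>distr ?MC (MX \<Otimes>\<^sub>M MZ) (\<lambda>\<omega>. (X \<omega>, Z' \<omega>)))"
    by (subst nn_integral_distr) (simp_all add: nn_integral_density indicator_times mult.commute del: nn_integral_indicator)
  also have "\<dots> = (\<integral>\<^sup>+p. r p * ((case p of (x, z) \<Rightarrow> ennreal (k x)) * indicator E p) \<partial>?L)"
    unfolding LC' dens by (simp add: nn_integral_density del: nn_integral_indicator)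
  also have "\<dots> = (\<integral>\<^sup>+p. r p * indicator E p \<partial>distr ?MC (MX \<Otimes>\<^sub>M MZ) (\<lambda>\<omega>. (X \<omega>, Z \<omega>)))"
    unfolding LC by (simp add: nn_integral_density ac_simps)
  also have "\<dots> = (\<integral>\<^sup>+\<omega>. r (X \<omega>, Z \<omega>) * indicator (E \<times> C) ((X \<omega>, Z \<omega>), U \<omega>) \<partial>M)"
    by (simp add: nn_integral_distr nn_integral_density indicator_times ac_simps)
  also have "\<dots> = emeasure (density (distr M ((MX \<Otimes>\<^sub>M MZ) \<Otimes>\<^sub>M MU) (\<lambda>\<omega>. ((X \<omega>, Z \<omega>), U \<omega>))) (\<lambda>p. r (fst p))) (E \<times> C)"
    by (simp add: emeasure_density nn_integral_distr)
  finally show "emeasure (distr M ((MX \<Otimes>\<^sub>M MZ) \<Otimes>\<^sub>M MU) (\<lambda>\<omega>. ((X \<omega>, Z' \<omega>), U \<omega>))) (E \<times> C) =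
    emeasure (density (distr M ((MX \<Otimes>\<^sub>M MZ) \<Otimes>\<^sub>M MU) (\<lambda>\<omega>. ((X \<omega>, Z \<omega>), U \<omega>))) (\<lambda>p. r (fst p))) (E \<times> C)" .
qed simp_all

section \<open>Composition of a measure with a Markov kernel\<close>

text \<open>The law of a pair whose first entry follows \<open>N\<close> and whose second entry,
  given that the first is \<open>x\<close>, follows \<open>K x\<close>. Written as a bind in the
  Giry monad, it inherits the integration rule for binds.\<close>

definition semidirect :: "'x measure \<Rightarrow> 'z measure \<Rightarrow> ('x \<Rightarrow> 'z measure) \<Rightarrow> ('x \<times> 'z) measure" where
  "semidirect N MZ K = N \<bind> (\<lambda>x. distr (K x) (N \<Otimes>\<^sub>M MZ) (Pair x))"

lemma measurable_semidirect_kernel: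
  assumes "K \<in> N \<rightarrow>\<^sub>M prob_algebra MZ"
  shows "(\<lambda>x. distr (K x) (N \<Otimes>\<^sub>M MZ) (Pair x)) \<in> N \<rightarrow>\<^sub>M subprob_algebra (N \<Otimes>\<^sub>M MZ)"
  by (intro measurable_distr2[where M=MZ] measurable_prob_algebraD[OF assms]) simp

lemma nn_integral_semidirect:
  assumes K: "K \<in> N \<rightarrow>\<^sub>M prob_algebra MZ" and f[measurable]: "f \<in> borel_measurable (N \<Otimes>\<^sub>M MZ)"
  shows "(\<integral>\<^sup>+p. f p \<partial>semidirect N MZ K) = (\<integral>\<^sup>+x. \<integral>\<^sup>+z. f (x, z) \<partial>K x \<partial>N)"
proof -
  have [measurable_cong]: "sets (K x) = sets MZ" if "x \<in> space N" for x
    using measurable_space[OF K that] by (simp add: space_prob_algebra)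
  show ?thesis
    unfolding semidirect_def
    by (subst nn_integral_bind[OF f measurable_semidirect_kernel[OF K]])
      (auto intro!: nn_integral_cong simp: nn_integral_distr)
qed

lemma sets_semidirect:
  assumes "K \<in> N \<rightarrow>\<^sub>M prob_algebra MZ" "space N \<noteq> {}"
  shows "sets (semidirect N MZ K) = sets (N \<Otimes>\<^sub>M MZ)"
  unfolding semidirect_def using assms(2) by (intro sets_bind) auto

lemma integral_kernel_measurable:
  fixes f :: "'x \<times> 'z \<Rightarrow> real"
  assumes K: "K \<in> N \<rightarrow>\<^sub>M prob_algebra MZ" and f[measurable]: "f \<in> borel_measurable (N \<Otimes>\<^sub>M MZ)"
  shows "(\<lambda>x. \<integral>z. f (x, z) \<partial>K x) \<in> borel_measurable N"
proof -
  let ?p = "\<lambda>x. \<integral>\<^sup>+z. ennreal (f (x, z)) \<partial>K x" and ?n = "\<lambda>x. \<integral>\<^sup>+z. ennreal (- f (x, z)) \<partial>K x"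
  have [measurable]: "?p \<in> borel_measurable N" "?n \<in> borel_measurable N"
    by (intro nn_integral_measurable_subprob_algebra2[OF _ measurable_prob_algebraD[OF K]]; simp)+
  \<comment> \<open>The Bochner integral takes the default value 0 at sections that are not
    integrable. The case distinction accounts for this, and its condition is measurable in
    \<open>x\<close>.\<close>
  have "(\<integral>z. f (x, z) \<partial>K x) =
      (if ?p x \<noteq> \<infinity> \<and> ?n x \<noteq> \<infinity> then enn2real (?p x) - enn2real (?n x) else 0)"
    if x: "x \<in> space N" for x
  proof -
    have sK: "sets (K x) = sets MZ"
      using measurable_space[OF K x] by (simp add: space_prob_algebra)
    have "(\<lambda>z. f (x, z)) \<in> borel_measurable (K x)"
      using measurable_compose[OF measurable_Pair1'[OF x] f]
      by (simp add: measurable_cong_sets[OF sK refl])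
    then have "integrable (K x) (\<lambda>z. f (x, z)) \<longleftrightarrow> ?p x \<noteq> \<infinity> \<and> ?n x \<noteq> \<infinity>"
      by (auto simp: real_integrable_def)
    then show ?thesis
      by (cases "integrable (K x) (\<lambda>z. f (x, z))")
        (auto simp: real_lebesgue_integral_def not_integrable_integral_eq)
  qed
  then show ?thesis
    by (subst measurable_cong, assumption) measurable
qed

text \<open>Fubini for kernels, obtained from the nonnegative formula for the positive and negative
  parts. Both parts have finite total integral, so almost every section is integrable and its
  integral is a difference of two finite terms.\<close>

lemma integral_semidirect:
  fixes f :: "'x \<times> 'z \<Rightarrow> real"
  assumes K: "K \<in> N \<rightarrow>\<^sub>M prob_algebra MZ" and f[measurable]: "f \<in> borel_measurable (N \<Otimes>\<^sub>M MZ)"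
    and int: "integrable (semidirect N MZ K) f"
  shows "(\<integral>p. f p \<partial>semidirect N MZ K) = (\<integral>x. \<integral>z. f (x, z) \<partial>K x \<partial>N)"
proof -
  let ?p = "\<lambda>x. \<integral>\<^sup>+z. ennreal (f (x, z)) \<partial>K x" and ?n = "\<lambda>x. \<integral>\<^sup>+z. ennreal (- f (x, z)) \<partial>K x"
  have sK: "sets (K x) = sets MZ" if "x \<in> space N" for x
    using measurable_space[OF K that] by (simp add: space_prob_algebra)
  have fK: "(\<lambda>z. f (x, z)) \<in> borel_measurable (K x)" if "x \<in> space N" for x
    using that by (subst measurable_cong_sets[OF sK refl]) simp_all
  have [measurable]: "?p \<in> borel_measurable N" "?n \<in> borel_measurable N"
    by (intro nn_integral_measurable_subprob_algebra2[OF _ measurable_prob_algebraD[OF K]]; simp)+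
  have pn: "(\<integral>\<^sup>+p. ennreal (f p) \<partial>semidirect N MZ K) = (\<integral>\<^sup>+x. ?p x \<partial>N)"
    "(\<integral>\<^sup>+p. ennreal (- f p) \<partial>semidirect N MZ K) = (\<integral>\<^sup>+x. ?n x \<partial>N)"
    by (intro nn_integral_semidirect[OF K]; simp)+
  then have fin: "(\<integral>\<^sup>+x. ?p x \<partial>N) \<noteq> \<infinity>" "(\<integral>\<^sup>+x. ?n x \<partial>N) \<noteq> \<infinity>"
    using int by (auto simp: real_integrable_def)
  have ae: "AE x in N. ?p x \<noteq> \<infinity>" "AE x in N. ?n x \<noteq> \<infinity>"
    using fin by (intro nn_integral_PInf_AE; simp)+
  \<comment> \<open>A finite integral forces \<open>g\<close> to be finite almost everywhere, so
    passing to \<open>enn2real\<close> alters it only on a null set.\<close>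
  have I: "integrable N (\<lambda>x. enn2real (g x))" "(\<integral>x. enn2real (g x) \<partial>N) = enn2real (\<integral>\<^sup>+x. g x \<partial>N)"
    if [measurable]: "g \<in> borel_measurable N" and "(\<integral>\<^sup>+x. g x \<partial>N) \<noteq> \<infinity>" for g
  proof -
    have "(\<integral>\<^sup>+x. ennreal (enn2real (g x)) \<partial>N) = (\<integral>\<^sup>+x. g x \<partial>N)"
      using nn_integral_PInf_AE[OF that] by (intro nn_integral_cong_AE) (auto simp: top.not_eq_extremum)
    then show "integrable N (\<lambda>x. enn2real (g x))" "(\<integral>x. enn2real (g x) \<partial>N) = enn2real (\<integral>\<^sup>+x. g x \<partial>N)"
      using that(2) by (auto intro!: integrableI_nonneg simp: integral_eq_nn_integral top.not_eq_extremum)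
  qed
  have "AE x in N. (\<integral>z. f (x, z) \<partial>K x) = enn2real (?p x) - enn2real (?n x)"
    using ae AE_space
  proof eventually_elim
    case (elim x)
    then have "integrable (K x) (\<lambda>z. f (x, z))"
      using fK by (auto simp: real_integrable_def)
    then show ?case
      by (rule real_lebesgue_integral_def)
  qed
  moreover have "(\<lambda>x. \<integral>z. f (x, z) \<partial>K x) \<in> borel_measurable N"
    by (rule integral_kernel_measurable[OF K f])
  ultimately have "(\<integral>x. \<integral>z. f (x, z) \<partial>K x \<partial>N) = (\<integral>x. enn2real (?p x) - enn2real (?n x) \<partial>N)"
    by (intro integral_cong_AE) auto
  also have "\<dots> = enn2real (\<integral>\<^sup>+x. ?p x \<partial>N) - enn2real (\<integral>\<^sup>+x. ?n x \<partial>N)"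
    using fin by (simp add: I)
  also have "\<dots> = (\<integral>p. f p \<partial>semidirect N MZ K)"
    by (simp add: real_lebesgue_integral_def[OF int] pn)
  finally show ?thesis by simp
qed

section \<open>Absolute continuity, from conditional laws to joint laws\<close>

text \<open>The mass of \<open>E\<close> is the \<open>N\<close>-integral of the masses of its
  sections. It vanishes exactly when almost every section is null, and this passes from
  \<open>K\<close> to \<open>K'\<close> pointwise.\<close>

lemma absolutely_continuous_semidirect:
  assumes N: "space N \<noteq> {}"
    and K: "K \<in> N \<rightarrow>\<^sub>M prob_algebra MZ" and K': "K' \<in> N \<rightarrow>\<^sub>M prob_algebra MZ"
    and ac: "AE x in N. absolutely_continuous (K x) (K' x)"
  shows "absolutely_continuous (semidirect N MZ K) (semidirect N MZ K')"
  unfolding absolutely_continuous_def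
proof
  fix E assume E: "E \<in> null_sets (semidirect N MZ K)"
  then have E'[measurable]: "E \<in> sets (N \<Otimes>\<^sub>M MZ)"
    using sets_semidirect[OF K N] by auto
  have em: "emeasure (semidirect N MZ L) E = (\<integral>\<^sup>+x. emeasure (L x) (Pair x -` E) \<partial>N)"
    if L: "L \<in> N \<rightarrow>\<^sub>M prob_algebra MZ" for L
  proof -
    have "emeasure (semidirect N MZ L) E = (\<integral>\<^sup>+p. indicator E p \<partial>semidirect N MZ L)"
      using sets_semidirect[OF L N] by simp
    also have "\<dots> = (\<integral>\<^sup>+x. \<integral>\<^sup>+z. indicator E (x, z) \<partial>L x \<partial>N)"
      by (rule nn_integral_semidirect[OF L]) simp
    also have "\<dots> = (\<integral>\<^sup>+x. emeasure (L x) (Pair x -` E) \<partial>N)"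
    proof (rule nn_integral_cong)
      fix x assume x: "x \<in> space N"
      have "Pair x -` E \<in> sets (L x)"
        using measurable_space[OF L x] sets_Pair1[OF E', of x] by (simp add: space_prob_algebra)
      then have "emeasure (L x) (Pair x -` E) = (\<integral>\<^sup>+z. indicator (Pair x -` E) z \<partial>L x)"
        by simp
      then show "(\<integral>\<^sup>+z. indicator E (x, z) \<partial>L x) = emeasure (L x) (Pair x -` E)"
        by (simp add: indicator_def)
    qed
    finally show ?thesis .
  qed
  have meas: "(\<lambda>x. emeasure (L x) (Pair x -` E)) \<in> borel_measurable N"
    if L: "L \<in> N \<rightarrow>\<^sub>M prob_algebra MZ" for L
  proof (rule emeasure_measurable_subprob_algebra2[OF _ measurable_prob_algebraD[OF L]])
    \<comment> \<open>The measurability rule speaks of a dependent family of sets; \<open>E\<close>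
      is recovered from its sections because it lies over \<open>space N\<close>.\<close>
    have "(SIGMA x:space N. Pair x -` E) = E"
      using sets.sets_into_space[OF E'] by (auto simp: space_pair_measure)
    then show "(SIGMA x:space N. Pair x -` E) \<in> sets (N \<Otimes>\<^sub>M MZ)" by simp
  qed
  have "AE x in N. emeasure (K x) (Pair x -` E) = 0"
    using E by (simp add: null_sets_def em[OF K] nn_integral_0_iff_AE[OF meas[OF K]])
  then have "AE x in N. emeasure (K' x) (Pair x -` E) = 0"
    using ac AE_space
  proof eventually_elim
    case (elim x)
    have "Pair x -` E \<in> sets (K x)"
      using measurable_space[OF K elim(3)] sets_Pair1[OF E', of x] by (simp add: space_prob_algebra)
    with elim(1,2) show ?case
      using absolutely_continuousD by blast
  qed
  then show "E \<in> null_sets (semidirect N MZ K')"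
    using sets_semidirect[OF K' N]
    by (simp add: null_sets_def em[OF K'] nn_integral_0_iff_AE[OF meas[OF K']])
qed

text \<open>At a point where \<open>f\<close> is 0, a positive \<open>g\<close> would make the ratio
  infinite; hence \<open>g\<close> vanishes almost everywhere that \<open>f\<close> does.\<close>

lemma absolutely_continuous_density_ratio:
  assumes f: "f \<in> borel_measurable M" and g: "g \<in> borel_measurable M"
    and fin: "AE x in M. g x / f x < (\<infinity>::ennreal)"
  shows "absolutely_continuous (density M f) (density M g)"
  unfolding absolutely_continuous_def
proof
  fix E assume "E \<in> null_sets (density M f)"
  then have E: "E \<in> sets M" "AE x in M. x \<in> E \<longrightarrow> f x = 0"
    using f by (auto simp: null_sets_density_iff)
  from E(2) fin have "AE x in M. x \<in> E \<longrightarrow> g x = 0"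
    by eventually_elim (auto simp: divide_ennreal_def ennreal_mult_top split: if_splits)
  then show "E \<in> null_sets (density M g)"
    using E g by (auto simp: null_sets_density_iff)
qed

section \<open>Disintegration of a joint law along a conditional density\<close>

text \<open>Integrating the almost sure identity between conditional probability and kernel mass
  over \<open>X \<in> D\<close> gives agreement on the rectangle \<open>D \<times> B\<close>, and
  rectangles determine the law.\<close>

lemma (in prob_space) conditional_density_distr:
  assumes X[measurable]: "X \<in> M \<rightarrow>\<^sub>M MX" and Z[measurable]: "Z \<in> M \<rightarrow>\<^sub>M MZ"
    and cd: "conditional_density M Z MZ X MX \<mu> h"
  shows "distr M (MX \<Otimes>\<^sub>M MZ) (\<lambda>\<omega>. (X \<omega>, Z \<omega>)) =
    semidirect (distr M MX X) MZ (\<lambda>x. density (\<mu> x) (h x))"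
proof (rule measure_eqI_rectangles[where A=MX and B=MZ])
  let ?N = "distr M MX X" and ?K = "\<lambda>x. density (\<mu> x) (h x)"
  have K: "?K \<in> MX \<rightarrow>\<^sub>M prob_algebra MZ"
    using cd by (simp add: conditional_density_def)
  then have K': "?K \<in> ?N \<rightarrow>\<^sub>M prob_algebra MZ"
    by simp
  have ne: "space ?N \<noteq> {}"
    using not_empty measurable_space[OF X] by auto
  have sets_eq: "sets (?N \<Otimes>\<^sub>M MZ) = sets (MX \<Otimes>\<^sub>M MZ)"
    by (intro sets_pair_measure_cong) simp_all
  show *: "sets (semidirect ?N MZ ?K) = sets (MX \<Otimes>\<^sub>M MZ)"
    using sets_semidirect[OF K' ne] sets_eq by simp
  show "finite_measure (distr M (MX \<Otimes>\<^sub>M MZ) (\<lambda>\<omega>. (X \<omega>, Z \<omega>)))"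
    by (intro finite_measure_distr) measurable
  fix D B assume D[measurable]: "D \<in> sets MX" and B[measurable]: "B \<in> sets MZ"
  let ?Z = "{\<omega> \<in> space M. Z \<omega> \<in> B}"
  have KX: "prob_space (?K (X \<omega>))" "sets (?K (X \<omega>)) = sets MZ" if "\<omega> \<in> space M" for \<omega>
    using measurable_space[OF K measurable_space[OF X that]] by (auto simp: space_prob_algebra)
  have [measurable]: "(\<lambda>x. measure (?K x) B) \<in> borel_measurable MX"
    using measurable_compose[OF measurable_prob_algebraD[OF K] measurable_emeasure_subprob_algebra[OF B]]
    unfolding measure_def by measurable
  have [measurable]: "cond_prob_given M X MX E \<in> borel_measurable M" for E
    unfolding cond_prob_given_def by (rule borel_measurable_cond_exp2)
  have DB: "D \<times> B \<in> sets (?N \<Otimes>\<^sub>M MZ)"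
    by (simp add: sets_eq)
  have "emeasure (distr M (MX \<Otimes>\<^sub>M MZ) (\<lambda>\<omega>. (X \<omega>, Z \<omega>))) (D \<times> B)
      = (\<integral>\<^sup>+\<omega>. ennreal (indicator D (X \<omega>) * indicator ?Z \<omega>) \<partial>M)"
    by (subst nn_integral_indicator[symmetric])
      (auto simp: nn_integral_distr simp del: nn_integral_indicator
        intro!: nn_integral_cong split: split_indicator)
  also have "\<dots> = ennreal (\<integral>\<omega>. indicator D (X \<omega>) * indicator ?Z \<omega> \<partial>M)"
    by (intro nn_integral_eq_integral integrable_const_bound[where B=1])
      (auto split: split_indicator)
  also have "(\<integral>\<omega>. indicator D (X \<omega>) * indicator ?Z \<omega> \<partial>M) =
      (\<integral>\<omega>. indicator D (X \<omega>) * cond_prob_given M X MX ?Z \<omega> \<partial>M)"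
    by (intro integral_cond_prob_given[symmetric]) (auto split: split_indicator)
  also have "\<dots> = (\<integral>\<omega>. indicator D (X \<omega>) * measure (?K (X \<omega>)) B \<partial>M)"
    using cd B by (intro integral_cong_AE) (auto simp: conditional_density_def)
  also have "ennreal \<dots> = (\<integral>\<^sup>+\<omega>. ennreal (indicator D (X \<omega>) * measure (?K (X \<omega>)) B) \<partial>M)"
    using KX(1)[THEN prob_space.prob_le_1]
    by (intro nn_integral_eq_integral[symmetric] integrable_const_bound[where B=1] AE_I2)
      (auto split: split_indicator)
  also have "\<dots> = (\<integral>\<^sup>+\<omega>. indicator D (X \<omega>) * emeasure (?K (X \<omega>)) B \<partial>M)"
    using KX(1)[THEN prob_space.finite_measure]
    by (intro nn_integral_cong) (auto simp: finite_measure.emeasure_eq_measure split: split_indicator)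
  also have "\<dots> = (\<integral>\<^sup>+x. indicator D x * emeasure (?K x) B \<partial>?N)"
    using measurable_compose[OF measurable_prob_algebraD[OF K] measurable_emeasure_subprob_algebra[OF B]]
    by (subst nn_integral_distr) simp_all
  also have "\<dots> = (\<integral>\<^sup>+x. \<integral>\<^sup>+z. indicator (D \<times> B) (x, z) \<partial>?K x \<partial>?N)"
  proof (intro nn_integral_cong)
    fix x assume "x \<in> space ?N"
    then have "sets (?K x) = sets MZ"
      using measurable_space[OF K, of x] by (simp add: space_prob_algebra)
    then show "indicator D x * emeasure (?K x) B = (\<integral>\<^sup>+z. indicator (D \<times> B) (x, z) \<partial>?K x)"
      using B by (simp add: indicator_times nn_integral_cmult)
  qed
  also have "\<dots> = (\<integral>\<^sup>+p. indicator (D \<times> B) p \<partial>semidirect ?N MZ ?K)"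
    using DB by (intro nn_integral_semidirect[symmetric, OF K']) simp
  also have "\<dots> = emeasure (semidirect ?N MZ ?K) (D \<times> B)"
    using D B * by simp
  finally show "emeasure (distr M (MX \<Otimes>\<^sub>M MZ) (\<lambda>\<omega>. (X \<omega>, Z \<omega>))) (D \<times> B) =
    emeasure (semidirect ?N MZ ?K) (D \<times> B)" .
qed simp

section \<open>Identification of the mean response under the intervention\<close>

theorem theorem1:
  fixes M :: "'s measure"
    and MUW :: "'uw measure" and MUZ :: "'uz measure"
    and MUA :: "'ua measure" and MUY :: "'uy measure"
    and MW :: "'w measure" and MZ :: "'z measure" and MA :: "'a measure"
    and UW :: "'s \<Rightarrow> 'uw" and UZ :: "'s \<Rightarrow> 'uz" and UA :: "'s \<Rightarrow> 'ua" and UY :: "'s \<Rightarrow> 'uy"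
    and fW :: "'uw \<Rightarrow> 'w" and fZ fZs :: "'w \<times> 'uz \<Rightarrow> 'z"
    and fA :: "'z \<times> 'w \<times> 'ua \<Rightarrow> 'a" and fY :: "'a \<times> 'w \<times> 'uy \<Rightarrow> real"
    and W :: "'s \<Rightarrow> 'w" and Z Zs :: "'s \<Rightarrow> 'z" and A As :: "'s \<Rightarrow> 'a" and Y Ys :: "'s \<Rightarrow> real"
    and P :: "('w \<times> 'z \<times> 'a \<times> real) measure"
    and \<mu> :: "'w \<Rightarrow> 'z measure" and h hs :: "'w \<Rightarrow> 'z \<Rightarrow> ennreal"
    and Hs :: "'w \<Rightarrow> 'z measure"
    and m :: "'z \<times> 'w \<Rightarrow> real"
  assumes "prob_space M"
    \<comment> \<open>error terms, with arbitrary joint distribution\<close>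
    and "UW \<in> M \<rightarrow>\<^sub>M MUW" and "UZ \<in> M \<rightarrow>\<^sub>M MUZ"
    and "UA \<in> M \<rightarrow>\<^sub>M MUA" and "UY \<in> M \<rightarrow>\<^sub>M MUY"
    \<comment> \<open>structural functions\<close>
    and "fW \<in> MUW \<rightarrow>\<^sub>M MW"
    and "fZ \<in> MW \<Otimes>\<^sub>M MUZ \<rightarrow>\<^sub>M MZ"
    and "fZs \<in> MW \<Otimes>\<^sub>M MUZ \<rightarrow>\<^sub>M MZ"
    and "fA \<in> MZ \<Otimes>\<^sub>M MW \<Otimes>\<^sub>M MUA \<rightarrow>\<^sub>M MA"
    and "fY \<in> MA \<Otimes>\<^sub>M MW \<Otimes>\<^sub>M MUY \<rightarrow>\<^sub>M borel"
    \<comment> \<open>natural model\<close>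
    and "\<And>\<omega>. \<omega> \<in> space M \<Longrightarrow> W \<omega> = fW (UW \<omega>)"
    and "\<And>\<omega>. \<omega> \<in> space M \<Longrightarrow> Z \<omega> = fZ (W \<omega>, UZ \<omega>)"
    and "\<And>\<omega>. \<omega> \<in> space M \<Longrightarrow> A \<omega> = fA (Z \<omega>, W \<omega>, UA \<omega>)"
    and "\<And>\<omega>. \<omega> \<in> space M \<Longrightarrow> Y \<omega> = fY (A \<omega>, W \<omega>, UY \<omega>)"
    and "cond_indep_given M Z MZ (\<lambda>\<omega>. (UA \<omega>, UY \<omega>)) (MUA \<Otimes>\<^sub>M MUY) W MW"
    and P: "P = distr M (MW \<Otimes>\<^sub>M MZ \<Otimes>\<^sub>M MA \<Otimes>\<^sub>M borel) (\<lambda>\<omega>. (W \<omega>, Z \<omega>, A \<omega>, Y \<omega>))"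
    and "conditional_density P (\<lambda>(w, z, a, y). z) MZ (\<lambda>(w, z, a, y). w) MW \<mu> h"
    \<comment> \<open>intervened model\<close>
    and "\<And>\<omega>. \<omega> \<in> space M \<Longrightarrow> Zs \<omega> = fZs (W \<omega>, UZ \<omega>)"
    and "\<And>\<omega>. \<omega> \<in> space M \<Longrightarrow> As \<omega> = fA (Zs \<omega>, W \<omega>, UA \<omega>)"
    and "\<And>\<omega>. \<omega> \<in> space M \<Longrightarrow> Ys \<omega> = fY (As \<omega>, W \<omega>, UY \<omega>)"
    and "conditional_density M Zs MZ W MW \<mu> hs"
    and "cond_indep_given M Zs MZ (\<lambda>\<omega>. (UA \<omega>, UY \<omega>)) (MUA \<Otimes>\<^sub>M MUY) W MW"
    and Hs: "\<And>w. w \<in> space MW \<Longrightarrow> Hs w = density (\<mu> w) (hs w)"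
    \<comment> \<open>overlap; in \<^typ>\<open>ennreal\<close>, \<open>c / 0 = \<infinity>\<close> for \<open>c > 0\<close> and \<open>0 / 0 = 0\<close>\<close>
    and "AE w in distr P MW (\<lambda>(w, z, a, y). w). AE z in \<mu> w. hs w z / h w z < \<infinity>"
    \<comment> \<open>existence of the expectations\<close>
    and "integrable M Y" and "integrable M Ys"
    \<comment> \<open>\<open>m (z, w) = E\<^sub>P[Y | Z = z, W = w]\<close>\<close>
    and "regression_version P (\<lambda>(w, z, a, y). y) (\<lambda>(w, z, a, y). (z, w)) (MZ \<Otimes>\<^sub>M MW) m"
  shows "(\<integral>\<omega>. Ys \<omega> \<partial>M) = (\<integral>(w, z', a, y). (\<integral>z. m (z, w) \<partial>Hs w) \<partial>P) \<and>
    (\<integral>\<omega>. Ys \<omega> \<partial>M) = (\<integral>w. (\<integral>z. m (z, w) \<partial>Hs w) \<partial>distr P MW (\<lambda>(w, z, a, y). w))"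
proof -
  interpret prob_space M by (rule assms(1))
  note [measurable] = assms(2-10)
  have W[measurable]: "W \<in> M \<rightarrow>\<^sub>M MW"
    by (subst measurable_cong[OF assms(11)]) simp_all
  have Z[measurable]: "Z \<in> M \<rightarrow>\<^sub>M MZ"
    by (subst measurable_cong[OF assms(12)]) simp_all
  have A[measurable]: "A \<in> M \<rightarrow>\<^sub>M MA"
    by (subst measurable_cong[OF assms(13)]) simp_all
  have Y[measurable]: "Y \<in> M \<rightarrow>\<^sub>M borel"
    by (subst measurable_cong[OF assms(14)]) simp_all
  have Zs[measurable]: "Zs \<in> M \<rightarrow>\<^sub>M MZ"
    by (subst measurable_cong[OF assms(18)]) simp_all
  \<comment> \<open>The errors are kept as a pair: they may be dependent given \<open>W\<close>, and
    only their joint independence from the instrument is available.\<close>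
  define U where "U = (\<lambda>\<omega>. (UA \<omega>, UY \<omega>))"
  have U[measurable]: "U \<in> M \<rightarrow>\<^sub>M MUA \<Otimes>\<^sub>M MUY"
    unfolding U_def by measurable
  have P_sets[measurable_cong]: "sets P = sets (MW \<Otimes>\<^sub>M MZ \<Otimes>\<^sub>M MA \<Otimes>\<^sub>M borel)"
    by (simp add: P)
  interpret P: prob_space P
    unfolding P by (rule prob_space_distr) measurable
  let ?w = "\<lambda>(w, z, a, y). w" and ?z = "\<lambda>(w, z, a, y). z" and ?y = "\<lambda>(w, z, a, y). y"
    and ?zw = "\<lambda>(w, z, a, y). (z, w)"
  have pr[measurable]: "?w \<in> P \<rightarrow>\<^sub>M MW" "?z \<in> P \<rightarrow>\<^sub>M MZ" "?y \<in> P \<rightarrow>\<^sub>M borel" "?zw \<in> P \<rightarrow>\<^sub>M MZ \<Otimes>\<^sub>M MW"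
    by measurable

  let ?N = "distr M MW W"
  let ?L = "distr M (MW \<Otimes>\<^sub>M MZ) (\<lambda>\<omega>. (W \<omega>, Z \<omega>))"
  let ?Ls = "distr M (MW \<Otimes>\<^sub>M MZ) (\<lambda>\<omega>. (W \<omega>, Zs \<omega>))"
  let ?H = "\<lambda>w. density (\<mu> w) (h w)" and ?Hs = "\<lambda>w. density (\<mu> w) (hs w)"
  \<comment> \<open>The density of \<open>Z\<close> is given under \<open>P\<close> and that of
    \<open>Zs\<close> under \<open>M\<close>. Both joint laws are expressed over the same law
    \<open>?N\<close> of \<open>W\<close>, so that their kernels can be compared.\<close>
  have N_P: "distr P MW ?w = ?N"
    unfolding P by (subst distr_distr) (auto simp: comp_def)
  have "distr P (MW \<Otimes>\<^sub>M MZ) (\<lambda>p. (?w p, ?z p)) = ?L"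
    unfolding P by (subst distr_distr) (auto simp: comp_def)
  then have L: "?L = semidirect ?N MZ ?H"
    using P.conditional_density_distr[OF pr(1,2) assms(17)] N_P by simp
  have Ls: "?Ls = semidirect ?N MZ ?Hs"
    by (rule conditional_density_distr[OF W Zs assms(21)])
  have H: "?H \<in> ?N \<rightarrow>\<^sub>M prob_algebra MZ" and Hs': "?Hs \<in> ?N \<rightarrow>\<^sub>M prob_algebra MZ"
    using assms(17,21) by (simp_all add: conditional_density_def)
  have ne: "space ?N \<noteq> {}"
    using not_empty measurable_space[OF W] by auto
  have "AE w in ?N. absolutely_continuous (?H w) (?Hs w)"
    using assms(24)[unfolded N_P] AE_space
  proof eventually_elim
    case (elim w)
    then have "h w \<in> borel_measurable (\<mu> w)" "hs w \<in> borel_measurable (\<mu> w)"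
      using assms(17,21) by (auto simp: conditional_density_def)
    then show ?case
      using elim(1) by (rule absolutely_continuous_density_ratio)
  qed
  then have ac: "absolutely_continuous ?L ?Ls"
    unfolding L Ls by (rule absolutely_continuous_semidirect[OF ne H Hs'])
  interpret L: prob_space ?L by (rule prob_space_distr) measurable
  interpret Ls: prob_space ?Ls by (rule prob_space_distr) measurable
  \<comment> \<open>A real-valued version of the derivative is chosen, so that it can multiply real
    integrands in Bochner integrals.\<close>
  obtain r where r': "r \<in> borel_measurable ?L" and
      r_RN: "AE p in ?L. RN_deriv ?L ?Ls p = ennreal (r p)" and r_nonneg: "\<And>p. 0 \<le> r p"
  proof (rule L.real_RN_deriv[OF Ls.finite_measure_axioms ac])
    show "sets ?Ls = sets ?L" by simp
  qed blast
  from r' have r[measurable]: "r \<in> borel_measurable (MW \<Otimes>\<^sub>M MZ)" by simp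
  have "?Ls = density ?L (RN_deriv ?L ?Ls)"
    using L.density_RN_deriv[OF ac] by simp
  also have "\<dots> = density ?L (\<lambda>p. ennreal (r p))"
    using r_RN by (intro density_cong) auto
  finally have dens: "?Ls = density ?L (\<lambda>p. ennreal (r p))" .

  let ?J = "(MW \<Otimes>\<^sub>M MZ) \<Otimes>\<^sub>M MUA \<Otimes>\<^sub>M MUY"
  let ?V = "\<lambda>\<omega>. ((W \<omega>, Z \<omega>), U \<omega>)" and ?Vs = "\<lambda>\<omega>. ((W \<omega>, Zs \<omega>), U \<omega>)"
  have joint: "distr M ?J ?Vs = density (distr M ?J ?V) (\<lambda>p. ennreal (r (fst p)))"
    using assms(15,22) by (intro distr_density_cond_indep[OF W Z Zs U _ _ _ dens]) (simp_all add: U_def)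
  \<comment> \<open>The exclusion restriction shows here: the instrument enters only through
    \<open>fA\<close>. Both responses are values of this one function, at \<open>?V\<close> and
    \<open>?Vs\<close>.\<close>
  define g where "g = (\<lambda>p. fY (fA (snd (fst p), fst (fst p), fst (snd p)), fst (fst p), snd (snd p)))"
  have g[measurable]: "g \<in> borel_measurable ?J"
    unfolding g_def by measurable
  have Y_g: "Y \<omega> = g (?V \<omega>)" "Ys \<omega> = g (?Vs \<omega>)" if "\<omega> \<in> space M" for \<omega>
    using that by (simp_all add: g_def U_def assms(13,14,19,20))
  have "integrable M Ys \<longleftrightarrow> integrable M (\<lambda>\<omega>. g (?Vs \<omega>))"
    by (rule Bochner_Integration.integrable_cong[OF refl Y_g(2)])
  then have "integrable M (\<lambda>\<omega>. g (?Vs \<omega>))"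
    using assms(26) by blast
  then have "integrable (distr M ?J ?Vs) g"
    by (subst integrable_distr_eq) simp_all
  then have "integrable (distr M ?J ?V) (\<lambda>p. r (fst p) * g p)"
    unfolding joint by (subst (asm) integrable_density) (simp_all add: r_nonneg)
  then have int_rg: "integrable M (\<lambda>\<omega>. r (W \<omega>, Z \<omega>) * g (?V \<omega>))"
    by (subst (asm) integrable_distr_eq) simp_all
  \<comment> \<open>Integrability of \<open>Ys\<close> becomes integrability of \<open>r\<close>
    times \<open>Y\<close> by the change of measure; this is what allows \<open>r\<close> to be
    pulled out of the conditional expectation below.\<close>
  have int_rY: "integrable P (\<lambda>p. r (?w p, ?z p) * ?y p)"
  proof -
    have "integrable M (\<lambda>\<omega>. r (W \<omega>, Z \<omega>) * Y \<omega>) \<longleftrightarrow>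
        integrable M (\<lambda>\<omega>. r (W \<omega>, Z \<omega>) * g (?V \<omega>))"
      by (intro Bochner_Integration.integrable_cong) (simp_all add: Y_g)
    then have "integrable M (\<lambda>\<omega>. r (W \<omega>, Z \<omega>) * Y \<omega>)"
      using int_rg by blast
    then show ?thesis
      unfolding P by (subst integrable_distr_eq) simp_all
  qed
  have "(\<integral>\<omega>. Ys \<omega> \<partial>M) = (\<integral>\<omega>. g (?Vs \<omega>) \<partial>M)"
    by (intro Bochner_Integration.integral_cong) (simp_all add: Y_g)
  also have "\<dots> = (\<integral>p. g p \<partial>distr M ?J ?Vs)"
    by (subst integral_distr) simp_all
  also have "\<dots> = (\<integral>p. r (fst p) * g p \<partial>distr M ?J ?V)"
    unfolding joint by (subst integral_density) (simp_all add: r_nonneg)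
  also have "\<dots> = (\<integral>\<omega>. r (W \<omega>, Z \<omega>) * g (?V \<omega>) \<partial>M)"
    by (subst integral_distr) simp_all
  also have "\<dots> = (\<integral>\<omega>. r (W \<omega>, Z \<omega>) * Y \<omega> \<partial>M)"
    by (intro Bochner_Integration.integral_cong) (simp_all add: Y_g)
  also have "\<dots> = (\<integral>p. r (?w p, ?z p) * ?y p \<partial>P)"
    unfolding P by (subst integral_distr) simp_all
  finally have Ys_P: "(\<integral>\<omega>. Ys \<omega> \<partial>M) = (\<integral>p. r (?w p, ?z p) * ?y p \<partial>P)" .

  let ?E = "real_cond_exp P (sigma_gen P ?zw (MZ \<Otimes>\<^sub>M MW)) ?y"
  \<comment> \<open>The regression conditions on \<open>(z, w)\<close>, whereas \<open>r\<close> is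
    a function of \<open>(w, z)\<close>; hence the swap.\<close>
  let ?\<phi> = "\<lambda>q. r (snd q, fst q)"
  have \<phi>: "?\<phi> (?zw p) = r (?w p, ?z p)" for p
    by (simp split: prod.split)
  have \<phi>_meas: "?\<phi> \<in> borel_measurable (MZ \<Otimes>\<^sub>M MW)"
    by measurable
  have m[measurable]: "m \<in> borel_measurable (MZ \<Otimes>\<^sub>M MW)" and m_ver: "AE p in P. m (?zw p) = ?E p"
    using assms(27) by (auto simp: regression_version_def)
  have [measurable]: "?E \<in> borel_measurable P"
    by (rule borel_measurable_cond_exp2)
  note cE = P.integral_cond_exp_sigma_gen[OF pr(4) \<phi>_meas pr(3), unfolded \<phi>, OF int_rY]
  have ae: "AE p in P. r (?w p, ?z p) * ?E p = r (?w p, ?z p) * m (?zw p)"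
    using m_ver by eventually_elim simp
  have "integrable P (\<lambda>p. r (?w p, ?z p) * m (?zw p))"
    using cE(1) by (rule integrable_cong_AE[THEN iffD1, OF _ _ ae, rotated 2]) measurable
  then have "integrable M (\<lambda>\<omega>. r (W \<omega>, Z \<omega>) * m (Z \<omega>, W \<omega>))"
    unfolding P by (subst (asm) integrable_distr_eq) simp_all
  then have "integrable ?L (\<lambda>p. r p * m (snd p, fst p))"
    by (subst integrable_distr_eq) simp_all
  \<comment> \<open>Integrability of \<open>m\<close> under the intervened law is derived:
    conditioning preserves integrability of the weighted response, and the weight \<open>r\<close>
    is then absorbed into \<open>?Ls\<close>.\<close>
  then have int_m: "integrable ?Ls (\<lambda>p. m (snd p, fst p))"
    unfolding dens by (subst integrable_density) (simp_all add: r_nonneg)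
  have "(\<integral>p. r (?w p, ?z p) * ?y p \<partial>P) = (\<integral>p. r (?w p, ?z p) * m (?zw p) \<partial>P)"
    unfolding cE(2)[symmetric] by (rule integral_cong_AE[OF _ _ ae]) measurable
  also have "\<dots> = (\<integral>\<omega>. r (W \<omega>, Z \<omega>) * m (Z \<omega>, W \<omega>) \<partial>M)"
    unfolding P by (subst integral_distr) simp_all
  also have "\<dots> = (\<integral>p. r p * m (snd p, fst p) \<partial>?L)"
    by (subst integral_distr) simp_all
  also have "\<dots> = (\<integral>p. m (snd p, fst p) \<partial>?Ls)"
    unfolding dens by (subst integral_density) (simp_all add: r_nonneg)
  also have "\<dots> = (\<integral>w. \<integral>z. m (z, w) \<partial>?Hs w \<partial>?N)"
    using int_m unfolding Ls by (subst integral_semidirect[OF Hs']) simp_all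
  \<comment> \<open>\<open>Hs\<close> is prescribed only on \<open>space MW\<close>, which suffices
    under the integral.\<close>
  also have "\<dots> = (\<integral>w. \<integral>z. m (z, w) \<partial>Hs w \<partial>?N)"
    by (intro Bochner_Integration.integral_cong) (simp_all add: Hs)
  finally have *: "(\<integral>\<omega>. Ys \<omega> \<partial>M) = (\<integral>w. \<integral>z. m (z, w) \<partial>Hs w \<partial>distr P MW ?w)"
    unfolding N_P Ys_P .
  \<comment> \<open>Measurability of the inner integral justifies the change of variables from the
    law of \<open>W\<close> back to \<open>P\<close>, which yields the first form of the
    identity.\<close>
  have "(\<lambda>w. \<integral>z. m (z, w) \<partial>?Hs w) \<in> borel_measurable MW"
    using assms(21) integral_kernel_measurable[where f="\<lambda>(w, z). m (z, w)" and N=MW and MZ=MZ and K="?Hs"]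
    by (simp add: conditional_density_def)
  then have meas: "(\<lambda>w. \<integral>z. m (z, w) \<partial>Hs w) \<in> borel_measurable MW"
    by (rule measurable_cong[THEN iffD1, rotated]) (simp add: Hs)
  have "(\<integral>w. \<integral>z. m (z, w) \<partial>Hs w \<partial>distr P MW ?w) = (\<integral>p. \<integral>z. m (z, ?w p) \<partial>Hs (?w p) \<partial>P)"
    by (rule integral_distr[OF pr(1) meas])
  also have "\<dots> = (\<integral>(w, z', a, y). (\<integral>z. m (z, w) \<partial>Hs w) \<partial>P)"
    by (intro Bochner_Integration.integral_cong) (auto split: prod.split)
  finally show ?thesis
    using * by simp
qed

end
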